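(* Let $I\subseteq\mathbb{R}$ be an open invex subset with respect to $\eta:I\times I\to\mathbb{R}_+$, let $f:I\to\mathbb{R}$ be an absolutely continuous mapping on $I$, and let $a,b\in I$ with $\eta(b,a)\neq 0$. Let $q\ge1$ be fixed. If $|f'|^q$ is preinvex on $I$ with respect to $\eta$, then $$\left|\frac{1}{6}\left[f(a)+4f\left(\frac{2a+\eta(b,a)}{2}\right)+f(a+\eta(b,a))\right]-\frac{1}{\eta(b,a)}\int_a^{a+\eta(b,a)}f(x)\,dx\right|$$ $$\le\eta(b,a)\left(\frac{5}{72}\right)^{1-\frac1q}\left\{\left(\frac{61|f'(a)|^q+29|f'(b)|^q}{1296}\right)^{\frac1q}+\left(\frac{29|f'(a)|^q+61|f'(b)|^q}{1296}\right)^{\frac1q}\right\}.$$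
   Context: $\mathbb{R}_+=[0,\infty)$. A set $I\subseteq\mathbb{R}$ is invex with respect to $\eta:I\times I\to\mathbb{R}_+$ if $u+t\,\eta(v,u)\in I$ for all $u,v\in I$ and all $t\in[0,1]$. A function $g:I\to\mathbb{R}$ on an invex set $I$ is preinvex with respect to $\eta$ if $g(u+t\,\eta(v,u))\le(1-t)g(u)+t\,g(v)$ for all $u,v\in I$, $t\in[0,1]$. $f'$ is the derivative of $f$; the hypothesis that $|f'|^q$ is preinvex on $I$ presupposes that $f'(x)$ exists at every $x\in I$. *)

theory Defs
  imports "HOL-Analysis.Analysis"
begin

(* \<eta> is a total function here; the typing \<eta> : I \<times> I \<rightarrow> [0,\<infinity>) is the nonnegativity clause. *)
definition invex_on :: "real set \<Rightarrow> (real \<Rightarrow> real \<Rightarrow> real) \<Rightarrow> bool" where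
  "invex_on I \<eta> \<longleftrightarrow>
     (\<forall>u\<in>I. \<forall>v\<in>I. 0 \<le> \<eta> v u) \<and>
     (\<forall>u\<in>I. \<forall>v\<in>I. \<forall>t\<in>{0..1}. u + t * \<eta> v u \<in> I)"

definition preinvex_on :: "real set \<Rightarrow> (real \<Rightarrow> real \<Rightarrow> real) \<Rightarrow> (real \<Rightarrow> real) \<Rightarrow> bool" where
  "preinvex_on I \<eta> g \<longleftrightarrow>
     invex_on I \<eta> \<and>
     (\<forall>u\<in>I. \<forall>v\<in>I. \<forall>t\<in>{0..1}. g (u + t * \<eta> v u) \<le> (1 - t) * g u + t * g v)"

(* The library constant absolutely_continuous is about measures.  Here D is a finite family of
   non-overlapping intervals [u,v], given by their endpoint pairs; each whole interval must lie
   in I, which matters when I is not itself an interval. *)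
definition absolutely_continuous_on :: "real set \<Rightarrow> (real \<Rightarrow> real) \<Rightarrow> bool" where
  "absolutely_continuous_on I f \<longleftrightarrow>
     (\<forall>\<epsilon>>0. \<exists>\<delta>>0. \<forall>D :: (real \<times> real) set.
        finite D \<and>
        (\<forall>(u, v)\<in>D. u < v \<and> {u..v} \<subseteq> I) \<and>
        pairwise (\<lambda>(u, v) (u', v'). disjnt {u<..<v} {u'<..<v'}) D \<and>
        (\<Sum>(u, v)\<in>D. v - u) < \<delta>
        \<longrightarrow> (\<Sum>(u, v)\<in>D. \<bar>f v - f u\<bar>) < \<epsilon>)"

end

theory Submission
  imports Defs
begin

text \<open>
  Rescale \<open>[a, a + \<eta> b a]\<close> to \<open>[0, 1]\<close> by \<open>g t = f (a + t * h) / h\<close>, where \<open>h = \<eta> b a\<close>, and cut at the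
  midpoint. Integrating \<open>(t - 1/6) * g' t\<close> by parts over \<open>[0, 1/2]\<close> gives
  \<open>g 0 / 6 + g (1/2) / 3 - \<integral> g\<close>, the error of the left half of Simpson's rule; the error of the right
  half is the same expression for the reflected function \<open>g (1 - t)\<close>, with the endpoint data
  exchanged. So one estimate on \<open>[0, 1/2]\<close> suffices, and its two uses produce the two summands of
  the bound.

  With \<open>A\<close> and \<open>B\<close> the values of \<open>\<bar>f'\<bar> powr q\<close> at \<open>a\<close> and \<open>b\<close>, preinvexity along the segment says
  \<open>\<bar>g' t\<bar> powr q \<le> (1 - t) * A + t * B\<close>. The classical argument now applies the power mean inequality
  with weight \<open>\<bar>t - 1/6\<bar>\<close>, whose total mass is \<open>5/72\<close>. Here that inequality is obtained from the
  tangent line of the concave function \<open>x powr (1/q)\<close> at the weighted mean of the affine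
  function \<open>(1 - t) * A + t * B\<close> (lemma \<open>powr_le_tangent\<close>): this replaces the bound on \<open>\<bar>g'\<bar>\<close> by
  an affine one, so that only the weighted integral of an affine function has to be computed
  (lemma \<open>has_integral_abs_kernel_times_affine\<close>), and the increment along the tangent
  integrates to zero (lemma \<open>half_Simpson_error_le\<close>).

  All integrals are Henstock-Kurzweil integrals: in that sense every derivative is integrable and
  satisfies the fundamental theorem of calculus, which justifies the integration by parts.
\<close>

text \<open>A concave function lies below its tangents; for powers this is Young's inequality
  \<open>x powr r * m powr (1 - r) \<le> r * x + (1 - r) * m\<close> divided by \<open>m powr (1 - r)\<close>.\<close>

lemma powr_le_tangent:
  fixes x m r :: real
  assumes "0 \<le> x" "0 < m" "0 < r" "r \<le> 1"
  shows "x powr r \<le> m powr r + r * m powr (r - 1) * (x - m)"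
proof (cases "x = 0")
  case True
  have "m powr (r - 1) * m = m powr r"
    using \<open>0 < m\<close> by (simp add: powr_diff)
  with True assms show ?thesis
    by (simp add: mult_left_le_one_le mult.assoc)
next
  case False
  with assms have "x powr r * m powr (1 - r) \<le> r * x + (1 - r) * m"
    by (intro Youngs_inequality_0) auto
  then have le: "x powr r * m powr (1 - r) * m powr (r - 1) \<le> (r * x + (1 - r) * m) * m powr (r - 1)"
    by (intro mult_right_mono) auto
  have "x powr r = x powr r * (m powr (1 - r) * m powr (r - 1))"
    using \<open>0 < m\<close> by (simp flip: powr_add)
  also have "\<dots> \<le> (r * x + (1 - r) * m) * m powr (r - 1)"
    using le by (simp only: mult.assoc)
  also have "\<dots> = m powr (r - 1) * m + r * m powr (r - 1) * (x - m)"
    by (simp add: algebra_simps)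
  also have "m powr (r - 1) * m = m powr r"
    using \<open>0 < m\<close> by (simp add: powr_diff)
  finally show ?thesis .
qed

text \<open>The source of the constants \<open>61\<close>, \<open>29\<close> and \<open>1296\<close>; for \<open>A = B = 1\<close> it gives the mass \<open>5/72\<close>
  of the kernel. The integrand is a quadratic polynomial on either side of \<open>1/6\<close>.\<close>

lemma has_integral_abs_kernel_times_affine:
  fixes A B :: real
  shows "((\<lambda>t. \<bar>t - 1/6\<bar> * ((1 - t) * A + t * B)) has_integral (61 * A + 29 * B) / 1296) {0..1/2}"
proof -
  define F where "F = (\<lambda>t. - A * t / 6 + (A - (B - A) / 6) * t^2 / 2 + (B - A) * t^3 / 3)"
  have F: "(F has_vector_derivative (t - 1/6) * ((1 - t) * A + t * B)) (at t within S)" for t S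
    unfolding F_def has_real_derivative_iff_has_vector_derivative[symmetric]
    by (auto intro!: derivative_eq_intros simp: field_simps power2_eq_square)
  have "((\<lambda>t. (t - 1/6) * ((1 - t) * A + t * B)) has_integral (F (1/6) - F 0)) {0..1/6}"
    by (intro fundamental_theorem_of_calculus F) auto
  then have "((\<lambda>t. - ((t - 1/6) * ((1 - t) * A + t * B))) has_integral - (F (1/6) - F 0)) {0..1/6}"
    by (rule has_integral_neg)
  then have 1: "((\<lambda>t. \<bar>t - 1/6\<bar> * ((1 - t) * A + t * B)) has_integral - (F (1/6) - F 0)) {0..1/6}"
    by (rule has_integral_eq[rotated]) (auto simp: abs_if simp flip: mult_minus_left)
  have "((\<lambda>t. (t - 1/6) * ((1 - t) * A + t * B)) has_integral (F (1/2) - F (1/6))) {1/6..1/2}"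
    by (intro fundamental_theorem_of_calculus F) auto
  then have 2: "((\<lambda>t. \<bar>t - 1/6\<bar> * ((1 - t) * A + t * B)) has_integral (F (1/2) - F (1/6))) {1/6..1/2}"
    by (rule has_integral_eq[rotated]) auto
  have val: "- (F (1/6) - F 0) + (F (1/2) - F (1/6)) = (61 * A + 29 * B) / 1296"
    by (simp add: F_def field_simps power2_eq_square power3_eq_cube)
  show ?thesis
    unfolding val[symmetric] by (rule has_integral_combine[OF _ _ 1 2]) auto
qed

text \<open>The constant \<open>1/6\<close> in the kernel is what makes integration by parts reproduce the Simpson
  weights: \<open>t - 1/6\<close> takes the values \<open>-1/6\<close> at \<open>0\<close> and \<open>1/3\<close> at \<open>1/2\<close>.\<close>

lemma half_Simpson_error_le_affine:
  fixes g g' :: "real \<Rightarrow> real" and A B :: real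
  assumes deriv: "\<And>t. t \<in> {0..1/2} \<Longrightarrow> (g has_real_derivative g' t) (at t within {0..1/2})"
    and bound: "\<And>t. t \<in> {0..1/2} \<Longrightarrow> \<bar>g' t\<bar> \<le> (1 - t) * A + t * B"
  shows "\<bar>g 0 / 6 + g (1/2) / 3 - integral {0..1/2} g\<bar> \<le> (61 * A + 29 * B) / 1296"
proof -
  have cont: "continuous_on {0..1/2} g"
    using deriv by (meson DERIV_continuous_on)
  have "((\<lambda>t. g t + (t - 1/6) * g' t) has_integral
      (1/2 - 1/6) * g (1/2) - (0 - 1/6) * g 0) {0..1/2}"
    by (rule fundamental_theorem_of_calculus)
       (auto intro!: derivative_eq_intros deriv
             simp flip: has_real_derivative_iff_has_vector_derivative)
  from has_integral_diff[OF this integrable_integral[OF integrable_continuous_real[OF cont]]]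
  have parts: "((\<lambda>t. (t - 1/6) * g' t) has_integral
      g 0 / 6 + g (1/2) / 3 - integral {0..1/2} g) {0..1/2}"
    by (simp add: add.commute)
  note affine = has_integral_abs_kernel_times_affine[of A B]
  have "norm (integral {0..1/2} (\<lambda>t. (t - 1/6) * g' t))
      \<le> integral {0..1/2} (\<lambda>t. \<bar>t - 1/6\<bar> * ((1 - t) * A + t * B))"
    using parts affine bound
    by (intro integral_norm_bound_integral)
       (auto simp: has_integral_iff abs_mult intro!: mult_left_mono)
  then show ?thesis
    using parts affine by (simp add: has_integral_iff)
qed

text \<open>The power mean step. The coefficient \<open>5/72\<close> is the mass of the kernel and
  \<open>m = (61 * A + 29 * B) / 90\<close> is the mean of \<open>(1 - t) * A + t * B\<close> with respect to it, so a tangent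
  taken at \<open>m\<close> has weighted integral exactly \<open>5/72 * m powr (1/q)\<close>.\<close>

lemma half_Simpson_error_le:
  fixes g g' :: "real \<Rightarrow> real" and A B q :: real
  assumes "q \<ge> 1" "A \<ge> 0" "B \<ge> 0"
    and deriv: "\<And>t. t \<in> {0..1/2} \<Longrightarrow> (g has_real_derivative g' t) (at t within {0..1/2})"
    and bound: "\<And>t. t \<in> {0..1/2} \<Longrightarrow> \<bar>g' t\<bar> powr q \<le> (1 - t) * A + t * B"
  shows "\<bar>g 0 / 6 + g (1/2) / 3 - integral {0..1/2} g\<bar>
    \<le> (5 / 72) powr (1 - 1 / q) * ((61 * A + 29 * B) / 1296) powr (1 / q)"
proof -
  define r where "r = 1 / q"
  define m where "m = (61 * A + 29 * B) / 90"
  have r: "0 < r" "r \<le> 1" using \<open>q \<ge> 1\<close> by (auto simp: r_def)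
  have root: "\<bar>g' t\<bar> \<le> ((1 - t) * A + t * B) powr r" if "t \<in> {0..1/2}" for t
  proof -
    have "\<bar>g' t\<bar> = (\<bar>g' t\<bar> powr q) powr r"
      using \<open>q \<ge> 1\<close> by (simp add: r_def powr_powr)
    also have "\<dots> \<le> ((1 - t) * A + t * B) powr r"
      using bound[OF that] r by (intro powr_mono2) auto
    finally show ?thesis .
  qed
  have "\<bar>g 0 / 6 + g (1/2) / 3 - integral {0..1/2} g\<bar> \<le> 5 / 72 * m powr r"
  proof (cases "m = 0")
    (* The tangent at m = 0 is vertical for q > 1, but then the derivative vanishes. *)
    case True
    then have "A = 0" "B = 0" using assms(2,3) by (auto simp: m_def)
    then show ?thesis
      using half_Simpson_error_le_affine[of g g' 0 0, OF deriv] root by (simp add: True)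
  next
    case False
    then have "m > 0" using assms(2,3) by (auto simp: m_def)
    (* The tangent at m is x \<mapsto> c + s * x; composed with an affine function it stays affine. *)
    define s where "s = r * m powr (r - 1)"
    define c where "c = m powr r - s * m"
    have "\<bar>g' t\<bar> \<le> (1 - t) * (c + s * A) + t * (c + s * B)" if t: "t \<in> {0..1/2}" for t
    proof -
      have "(1 - t) * A + t * B \<ge> 0" using assms(2,3) t by auto
      from powr_le_tangent[OF this \<open>m > 0\<close> r] root[OF t] show ?thesis
        by (simp add: c_def s_def algebra_simps)
    qed
    from half_Simpson_error_le_affine[OF deriv this]
    have "\<bar>g 0 / 6 + g (1/2) / 3 - integral {0..1/2} g\<bar>
        \<le> (61 * (c + s * A) + 29 * (c + s * B)) / 1296" .
    also have "\<dots> = 5 / 72 * (c + s * m)"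
      by (simp add: m_def field_simps)
    finally show ?thesis by (simp add: c_def)
  qed
  also have "5 / 72 * m powr r = (5 / 72) powr (1 - r) * (5 / 72 * m) powr r"
  proof -
    have "m \<ge> 0" using assms(2,3) by (simp add: m_def)
    then have "(5 / 72 * m) powr r = (5 / 72) powr r * m powr r"
      by (simp only: powr_mult)
    then show ?thesis by (simp add: powr_diff)
  qed
  also have "5 / 72 * m = (61 * A + 29 * B) / 1296"
    by (simp add: m_def)
  finally show ?thesis by (simp add: r_def)
qed

theorem theorem4:
  fixes I :: "real set" and \<eta> :: "real \<Rightarrow> real \<Rightarrow> real" and f :: "real \<Rightarrow> real"
    and a b q :: real
  assumes "open I" and "invex_on I \<eta>"
    and "absolutely_continuous_on I f"
    and "a \<in> I" and "b \<in> I" and "\<eta> b a \<noteq> 0"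
    and "q \<ge> 1"
    and "\<And>x. x \<in> I \<Longrightarrow> f differentiable (at x)"
    and "preinvex_on I \<eta> (\<lambda>x. \<bar>deriv f x\<bar> powr q)"
  shows "\<bar>1 / 6 * (f a + 4 * f ((2 * a + \<eta> b a) / 2) + f (a + \<eta> b a))
            - 1 / \<eta> b a * integral {a..a + \<eta> b a} f\<bar>
         \<le> \<eta> b a * (5 / 72) powr (1 - 1 / q) *
            (((61 * \<bar>deriv f a\<bar> powr q + 29 * \<bar>deriv f b\<bar> powr q) / 1296) powr (1 / q)
             + ((29 * \<bar>deriv f a\<bar> powr q + 61 * \<bar>deriv f b\<bar> powr q) / 1296) powr (1 / q))"
proof -
  define h where "h = \<eta> b a"
  define A where "A = \<bar>deriv f a\<bar> powr q"
  define B where "B = \<bar>deriv f b\<bar> powr q"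
  have h: "h > 0"
    using assms(2,4,5,6) by (auto simp: invex_on_def h_def less_le)
  have AB: "A \<ge> 0" "B \<ge> 0" by (auto simp: A_def B_def)
  have mem: "a + t * h \<in> I" if "t \<in> {0..1}" for t
    using assms(2,4,5) that by (auto simp: invex_on_def h_def)
  have bound: "\<bar>deriv f (a + t * h)\<bar> powr q \<le> (1 - t) * A + t * B" if "t \<in> {0..1}" for t
    using assms(4,5,9) that by (auto simp: preinvex_on_def h_def A_def B_def)
  have deriv: "(f has_real_derivative deriv f (a + t * h)) (at (a + t * h))" if "t \<in> {0..1}" for t
    using assms(8)[OF mem[OF that]] DERIV_deriv_iff_real_differentiable by blast
  define g where "g = (\<lambda>t. f (a + t * h) / h)"
  define J where "J = integral {0..1/2} g"
  define K where "K = integral {0..1/2} (\<lambda>t. g (1 - t))"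
  have g: "(g has_real_derivative deriv f (a + t * h)) (at t within S)" if "t \<in> {0..1}" for t S
  proof -
    have "((\<lambda>t. a + t * h) has_real_derivative h) (at t within S)"
      by (auto intro!: derivative_eq_intros)
    from DERIV_cdivide[OF DERIV_chain2[where f = f, OF deriv[OF that] this], of h]
    show ?thesis using h by (simp add: g_def)
  qed
  have left: "\<bar>g 0 / 6 + g (1/2) / 3 - J\<bar>
      \<le> (5 / 72) powr (1 - 1 / q) * ((61 * A + 29 * B) / 1296) powr (1 / q)"
    unfolding J_def using assms(7) AB
    by (rule half_Simpson_error_le[where g' = "\<lambda>t. deriv f (a + t * h)"]) (auto intro!: g bound)
  have right: "\<bar>g 1 / 6 + g (1/2) / 3 - K\<bar>
      \<le> (5 / 72) powr (1 - 1 / q) * ((29 * A + 61 * B) / 1296) powr (1 / q)"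
  proof -
    have "((\<lambda>t. g (1 - t)) has_real_derivative - deriv f (a + (1 - t) * h)) (at t within {0..1/2})"
      if "t \<in> {0..1/2}" for t
    proof -
      have "((\<lambda>t. g (1 - t)) has_real_derivative deriv f (a + (1 - t) * h) * (- 1)) (at t)"
        by (rule DERIV_chain2[OF g]) (use that in \<open>auto intro!: derivative_eq_intros\<close>)
      then show ?thesis by (simp add: has_field_derivative_at_within)
    qed
    moreover have "\<bar>- deriv f (a + (1 - t) * h)\<bar> powr q \<le> (1 - t) * B + t * A"
      if "t \<in> {0..1/2}" for t
      using bound[of "1 - t"] that by simp
    ultimately have "\<bar>g (1 - 0) / 6 + g (1 - 1/2) / 3 - K\<bar>
        \<le> (5 / 72) powr (1 - 1 / q) * ((61 * B + 29 * A) / 1296) powr (1 / q)"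
      unfolding K_def using assms(7) AB by (intro half_Simpson_error_le) auto
    then show ?thesis by (simp add: add.commute)
  qed
  have gint: "g integrable_on {0..1}"
    by (meson g DERIV_continuous_on integrable_continuous_real)
  have JK: "J + K = integral {0..1} g"
  proof -
    have "(g has_integral integral {1/2..1} g) (cbox (1/2) 1)"
      using integrable_subinterval_real[OF gint, of "1/2" 1] by (simp add: integrable_integral)
    from has_integral_affinity[OF this, of "- 1" 1]
    have "K = integral {1/2..1} g"
      unfolding K_def by (intro integral_unique) (simp add: image_affinity_cbox)
    then show ?thesis
      unfolding J_def using Henstock_Kurzweil_Integration.integral_combine[OF _ _ gint, of "1/2"] by simp
  qed
  have int: "integral {0..1} g = integral {a..a + h} f / h\<^sup>2"
  proof -
    have "isCont f x" if "x \<in> {a..a + h}" for x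
    proof -
      have "x = a + ((x - a) / h) * h" using h by simp
      moreover have "(x - a) / h \<in> {0..1}" using that h by (auto simp: field_simps)
      ultimately show ?thesis using deriv DERIV_isCont by metis
    qed
    then have "f integrable_on {a..a + h}"
      by (intro integrable_continuous_real continuous_at_imp_continuous_on) auto
    then have "(f has_integral integral {a..a + h} f) (cbox a (a + h))"
      by (simp add: integrable_integral)
    from has_integral_affinity'[OF this h, of a]
    have "((\<lambda>t. f (a + t * h)) has_integral integral {a..a + h} f / h) {0..1}"
      using h by (simp add: ac_simps divide_inverse)
    then show ?thesis
      unfolding g_def using h
      by (intro integral_unique) (auto dest: has_integral_divide[of _ _ _ h] simp: power2_eq_square)
  qed
  have "1 / 6 * (f a + 4 * f ((2 * a + h) / 2) + f (a + h)) - 1 / h * integral {a..a + h} f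
      = h * ((g 0 / 6 + g (1/2) / 3 - J) + (g 1 / 6 + g (1/2) / 3 - K))"
  proof -
    have "h * (g 0 / 6 + 4 * g (1/2) / 6 + g 1 / 6) = 1 / 6 * (f a + 4 * f ((2 * a + h) / 2) + f (a + h))"
      using h by (simp add: g_def field_simps)
    moreover have "h * (J + K) = 1 / h * integral {a..a + h} f"
      unfolding JK int using h by (simp add: power2_eq_square)
    ultimately show ?thesis by (simp add: algebra_simps)
  qed
  also have "\<bar>\<dots>\<bar> \<le> h * ((5 / 72) powr (1 - 1 / q) * ((61 * A + 29 * B) / 1296) powr (1 / q)
      + (5 / 72) powr (1 - 1 / q) * ((29 * A + 61 * B) / 1296) powr (1 / q))"
    unfolding abs_mult using left right h by (intro mult_mono) auto
  finally show ?thesis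
    by (simp add: h_def A_def B_def algebra_simps)
qed

end
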